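(* Let $\Delta\subset\mathfrak d^*$ be an $n$-dimensional convex polytope (not necessarily rational or simple), with a choice of inward-pointing normals $X_1,\dots,X_d\in\mathfrak d$ and of a quasilattice $Q\subset\mathfrak d$ containing them, and let $N$, $\Psi$, $\Upsilon$, $\pi$ and $M=\Psi^{-1}(0)/N$ be the associated objects described in the context. Then the $n$-dimensional quasitorus $D=\mathfrak d/Q$ acts continuously and effectively on the topological space $M$ (the action being the one induced by the $T^d$-action on $\Psi^{-1}(0)$ through the isomorphism $T^d/N\cong D$). Moreover $M$ is compact, and a continuous mapping $\Phi\colon M\to\mathfrak d^*$ is defined, namely $\Phi([\underline z])=(\pi^* )^{-1}(\Upsilon(\underline z))$, such that $\Phi(M)=\Delta$.
   Context: Let $\mathfrak d$ be a real vector space of dimension $n$ and let $\Delta\subset\mathfrak d^*$ be an $n$-dimensional convex polytope, written as $\Delta=\bigcap_{j=1}^d\{\mu\in\mathfrak d^*\mid\langle\mu,X_j\rangle\ge\lambda_j\}$, where $X_1,\dots,X_d\in\mathfrak d$ are inward-pointing normals, one for each codimension-$1$ face of $\Delta$, and $\lambda_j\in\mathbb R$ are the corresponding constants. A quasilattice in $\mathfrak d$ is the $\mathbb Z$-span of a finite set of vectors that span $\mathfrak d$ over $\mathbb R$. Let $Q$ be a quasilattice in $\mathfrak d$ containing $X_1,\dots,X_d$. The $n$-dimensional quasitorus is the group $D=\mathfrak d/Q$ (with the quotient topology, possibly non-Hausdorff). Let $e_1,\dots,e_d$ be the standard basis of $\mathbb R^d$, $e_j^*$ the dual basis, and $\pi\colon\mathbb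 R^d\to\mathfrak d$ the surjective linear map with $\pi(e_j)=X_j$. Let $T^d=\mathbb R^d/\mathbb Z^d$, with quotient map $\exp\colon\mathbb R^d\to T^d$, acting on $\mathbb C^d$ by $\exp(x)\cdot\underline z=(e^{2\pi i x_1}z_1,\dots,e^{2\pi i x_d}z_d)$. The map $\pi$ induces a surjective homomorphism $\Pi\colon T^d\to\mathfrak d/Q$; put $N=\ker\Pi$, so that $T^d/N\cong\mathfrak d/Q$. $N$ is an (in general nonclosed) immersed Lie subgroup with Lie algebra $\mathfrak n=\ker\pi$; let $\iota\colon\mathfrak n\to\mathbb R^d$ be the inclusion. Define $\Upsilon\colon\mathbb C^d\to(\mathbb R^d)^*$ by $\Upsilon(\underline z)=\sum_{j=1}^d(|z_j|^2+\lambda_j)e_j^*$ and $\Psi=\iota^*\circ\Upsilon\colon\mathbb C^d\to\mathfrak n^*$. The space $M=\Psi^{-1}(0)/N$ is endowed with the quotient topology. From the exact sequence $0\to\mathfrak d^*\xrightarrow{\pi^*}(\mathbb R^d)^*\xrightarrow{\iota^*}\mathfrak n^*\to0$, for $\underline z\in\Psi^{-1}(0)$ the element $\Upsilon(\underline z)$ lies in the image of the injective map $\pi^*$. Compact means that every open cover has a finite subcover (no Hausdorff assumption). *)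

theory Defs
  imports "HOL-Analysis.Analysis" "HOL-Algebra.Group_Action"
begin

text \<open>
  Throughout, \<open>'v\<close> is the space \<open>\<dd>\<close>, of dimension \<open>DIM('v)\<close>; its inner product is never used.
  The dual \<open>\<dd>\<^sup>*\<close> is \<open>'v \<Rightarrow>\<^sub>L real\<close>: in finite dimension every linear functional is bounded and
  the norm topology is the vector space topology.  The finite type \<open>'d\<close> indexes the facets, so
  that \<open>\<real>\<^sup>d\<close> and \<open>\<complex>\<^sup>d\<close> are \<open>real ^ 'd\<close> and \<open>complex ^ 'd\<close>.
\<close>

text \<open>
  The dimension of the affine hull of a nonempty set.  The library's \<open>aff_dim\<close> and \<open>facet_of\<close>
  require a Euclidean space, which the dual \<open>'v \<Rightarrow>\<^sub>L real\<close> is not an instance of; on Euclidean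
  spaces the notions agree, see \<open>hull_dim_eq_aff_dim\<close>.
\<close>

definition hull_dim :: "'a::real_vector set \<Rightarrow> nat" where
  "hull_dim S = dim {x - y | x y. x \<in> S \<and> y \<in> S}"

lemma hull_dim_eq_aff_dim:
  fixes S :: "'a::euclidean_space set"
  assumes "S \<noteq> {}"
  shows "int (hull_dim S) = aff_dim S"
proof -
  obtain a where a: "a \<in> S" using assms by blast
  have "span {x - y | x y. x \<in> S \<and> y \<in> S} = span ((+) (- a) ` S)"
  proof (rule span_eq[THEN iffD2], intro conjI subsetI)
    fix v assume "v \<in> {x - y | x y. x \<in> S \<and> y \<in> S}"
    then obtain x y where "v = (- a + x) - (- a + y)" "x \<in> S" "y \<in> S" by auto
    then show "v \<in> span ((+) (- a) ` S)" by (metis imageI span_base span_diff)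
  next
    fix v assume "v \<in> (+) (- a) ` S"
    then obtain x where "v = x - a" "x \<in> S" by auto
    then show "v \<in> span {x - y | x y. x \<in> S \<and> y \<in> S}" using a by (intro span_base) blast
  qed
  then have "hull_dim S = dim ((+) (- a) ` S)"
    unfolding hull_dim_def by (rule span_eq_dim)
  moreover have "aff_dim S = int (dim ((+) (- a) ` S))"
    by (rule aff_dim_eq_dim) (rule hull_inc[OF a])
  ultimately show ?thesis by (simp only:)
qed

definition codim1_face_of :: "'a::real_vector set \<Rightarrow> 'a set \<Rightarrow> bool" where
  "codim1_face_of F S \<longleftrightarrow> F face_of S \<and> F \<noteq> {} \<and> hull_dim F + 1 = hull_dim S"

definition quot_topology :: "'a topology \<Rightarrow> ('a \<Rightarrow> 'b) \<Rightarrow> 'b topology" where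
  "quot_topology T p =
     topology (\<lambda>U. U \<subseteq> p ` topspace T \<and> openin T {x \<in> topspace T. p x \<in> U})"

lemma openin_quot_topology:
  "openin (quot_topology T p) U \<longleftrightarrow> U \<subseteq> p ` topspace T \<and> openin T {x \<in> topspace T. p x \<in> U}"
proof -
  have "istopology (\<lambda>U. U \<subseteq> p ` topspace T \<and> openin T {x \<in> topspace T. p x \<in> U})"
    unfolding istopology_def
  proof (intro conjI allI impI)
    fix A B assume "A \<subseteq> p ` topspace T \<and> openin T {x \<in> topspace T. p x \<in> A}"
      "B \<subseteq> p ` topspace T \<and> openin T {x \<in> topspace T. p x \<in> B}"
    moreover have "{x \<in> topspace T. p x \<in> A \<inter> B} =
        {x \<in> topspace T. p x \<in> A} \<inter> {x \<in> topspace T. p x \<in> B}" by blast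
    ultimately show "A \<inter> B \<subseteq> p ` topspace T" "openin T {x \<in> topspace T. p x \<in> A \<inter> B}"
      by (blast, simp only: openin_Int)
  next
    fix K assume K: "\<forall>A\<in>K. A \<subseteq> p ` topspace T \<and> openin T {x \<in> topspace T. p x \<in> A}"
    then show "\<Union>K \<subseteq> p ` topspace T" by blast
    have "{x \<in> topspace T. p x \<in> \<Union>K} = \<Union>((\<lambda>A. {x \<in> topspace T. p x \<in> A}) ` K)" by blast
    also have "openin T \<dots>" using K by blast
    finally show "openin T {x \<in> topspace T. p x \<in> \<Union>K}" .
  qed
  then show ?thesis by (simp add: quot_topology_def)
qed

lemma topspace_quot_topology: "topspace (quot_topology T p) = p ` topspace T"
proof
  show "topspace (quot_topology T p) \<subseteq> p ` topspace T"
    using openin_topspace[of "quot_topology T p"] by (simp only: openin_quot_topology)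
  have "{x \<in> topspace T. p x \<in> p ` topspace T} = topspace T" by blast
  then have "openin (quot_topology T p) (p ` topspace T)"
    by (simp add: openin_quot_topology)
  then show "p ` topspace T \<subseteq> topspace (quot_topology T p)" by (rule openin_subset)
qed

lemma quotient_map_quot_topology: "quotient_map T (quot_topology T p) p"
  unfolding quotient_map_def topspace_quot_topology openin_quot_topology by simp

definition quasilattice :: "'v::real_vector set \<Rightarrow> bool" where
  "quasilattice Q \<longleftrightarrow>
     (\<exists>S. finite S \<and> span S = UNIV \<and> Q = {\<Sum>s\<in>S. of_int (c s) *\<^sub>R s | c :: 'v \<Rightarrow> int. True})"

definition vec_group :: "'v::ab_group_add monoid" where
  "vec_group = \<lparr>carrier = UNIV, mult = (+), one = 0\<rparr>"

definition quasitorus :: "'v::ab_group_add set \<Rightarrow> 'v set monoid" where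
  "quasitorus Q = vec_group Mod Q"

definition quasitorus_proj :: "'v::ab_group_add set \<Rightarrow> 'v \<Rightarrow> 'v set" where
  "quasitorus_proj Q x = Q #>\<^bsub>vec_group\<^esub> x"

definition quasitorus_topology :: "'v::real_normed_vector set \<Rightarrow> 'v set topology" where
  "quasitorus_topology Q = quot_topology euclidean (quasitorus_proj Q)"

definition int_lattice :: "(real ^ 'd) set" where
  "int_lattice = {x. \<forall>j. x $ j \<in> \<int>}"

definition torus :: "(real ^ 'd) set monoid" where
  "torus = vec_group Mod int_lattice"

text \<open>
  Here and below, a map on a quotient is given by a formula in representatives: \<open>the_elem\<close> picks
  the common value of the formula on all representatives.
\<close>

definition torus_act :: "(real ^ 'd) set \<Rightarrow> complex ^ 'd \<Rightarrow> complex ^ 'd" where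
  "torus_act t z =
     the_elem ((\<lambda>x. \<chi> j. exp (2 * of_real pi * \<i> * of_real (x $ j)) * z $ j) ` t)"

definition proj :: "('d::finite \<Rightarrow> 'v::euclidean_space) \<Rightarrow> (real ^ 'd) \<Rightarrow>\<^sub>L 'v" where
  "proj X = Blinfun (\<lambda>x. \<Sum>j\<in>UNIV. x $ j *\<^sub>R X j)"

lemma proj_apply:
  fixes X :: "'d::finite \<Rightarrow> 'v::euclidean_space"
  shows "blinfun_apply (proj X) x = (\<Sum>j\<in>UNIV. x $ j *\<^sub>R X j)"
proof -
  have "bounded_linear (\<lambda>x::real^'d. \<Sum>j\<in>UNIV. x $ j *\<^sub>R X j)"
    by (rule bounded_linear_sum) (rule bounded_linear_compose[OF bounded_linear_scaleR_left bounded_linear_vec_nth])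
  then show ?thesis by (simp add: proj_def bounded_linear_Blinfun_apply)
qed

definition torus_proj ::
  "('d::finite \<Rightarrow> 'v::euclidean_space) \<Rightarrow> 'v set \<Rightarrow> (real ^ 'd) set \<Rightarrow> 'v set" where
  "torus_proj X Q t = the_elem ((\<lambda>x. quasitorus_proj Q (blinfun_apply (proj X) x)) ` t)"

definition N_group ::
  "('d::finite \<Rightarrow> 'v::euclidean_space) \<Rightarrow> 'v set \<Rightarrow> (real ^ 'd) set monoid" where
  "N_group X Q = torus \<lparr>carrier := kernel torus (quasitorus Q) (torus_proj X Q)\<rparr>"

definition dual_basis :: "'d::finite \<Rightarrow> (real ^ 'd) \<Rightarrow>\<^sub>L real" where
  "dual_basis j = Blinfun (\<lambda>x. x $ j)"

lemma dual_basis_apply: "blinfun_apply (dual_basis j) x = x $ j"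
  by (simp add: dual_basis_def bounded_linear_Blinfun_apply bounded_linear_vec_nth)

definition Upsilon :: "('d::finite \<Rightarrow> real) \<Rightarrow> complex ^ 'd \<Rightarrow> ((real ^ 'd) \<Rightarrow>\<^sub>L real)" where
  "Upsilon lam z = (\<Sum>j\<in>UNIV. ((cmod (z $ j))\<^sup>2 + lam j) *\<^sub>R dual_basis j)"

definition n_space :: "('d::finite \<Rightarrow> 'v::euclidean_space) \<Rightarrow> (real ^ 'd) set" where
  "n_space X = {x. blinfun_apply (proj X) x = 0}"

text \<open>
  Elements of the dual of the subspace \<open>\<nn>\<close> are functionals restricted to \<open>\<nn>\<close> (extensional
  functions), and its zero is the restriction of the zero functional.
\<close>

definition iota_star ::
  "('d::finite \<Rightarrow> 'v::euclidean_space) \<Rightarrow> ((real ^ 'd) \<Rightarrow>\<^sub>L real) \<Rightarrow> real ^ 'd \<Rightarrow> real" where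
  "iota_star X f = restrict (blinfun_apply f) (n_space X)"

definition Psi ::
  "('d::finite \<Rightarrow> 'v::euclidean_space) \<Rightarrow> ('d \<Rightarrow> real) \<Rightarrow> complex ^ 'd \<Rightarrow> real ^ 'd \<Rightarrow> real" where
  "Psi X lam = iota_star X \<circ> Upsilon lam"

definition zero_level ::
  "('d::finite \<Rightarrow> 'v::euclidean_space) \<Rightarrow> ('d \<Rightarrow> real) \<Rightarrow> (complex ^ 'd) set" where
  "zero_level X lam = {z. Psi X lam z = (\<lambda>x\<in>n_space X. 0)}"

definition N_orbit ::
  "('d::finite \<Rightarrow> 'v::euclidean_space) \<Rightarrow> 'v set \<Rightarrow> complex ^ 'd \<Rightarrow> (complex ^ 'd) set" where
  "N_orbit X Q z = orbit (N_group X Q) torus_act z"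

definition M_space ::
  "('d::finite \<Rightarrow> 'v::euclidean_space) \<Rightarrow> ('d \<Rightarrow> real) \<Rightarrow> 'v set \<Rightarrow> (complex ^ 'd) set set" where
  "M_space X lam Q = orbits (N_group X Q) (zero_level X lam) torus_act"

definition M_topology ::
  "('d::finite \<Rightarrow> 'v::euclidean_space) \<Rightarrow> ('d \<Rightarrow> real) \<Rightarrow> 'v set \<Rightarrow> (complex ^ 'd) set topology" where
  "M_topology X lam Q =
     quot_topology (subtopology euclidean (zero_level X lam)) (N_orbit X Q)"

lemma topspace_M_topology: "topspace (M_topology X lam Q) = M_space X lam Q"
  by (auto simp: M_topology_def topspace_quot_topology M_space_def orbits_def N_orbit_def)

text \<open>
  The isomorphism \<open>T\<^sup>d/N \<cong> \<dd>/Q\<close> sends the class of \<open>t\<close> to \<open>\<Pi>(t)\<close>, so an element \<open>\<delta>\<close> acts as any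
  \<open>t\<close> with \<open>\<Pi>(t) = \<delta>\<close>.  Restricting to \<open>M\<close> makes the map an element of \<open>BijGroup\<close>.
\<close>

definition quasitorus_act ::
  "('d::finite \<Rightarrow> 'v::euclidean_space) \<Rightarrow> ('d \<Rightarrow> real) \<Rightarrow> 'v set \<Rightarrow>
     'v set \<Rightarrow> (complex ^ 'd) set \<Rightarrow> (complex ^ 'd) set" where
  "quasitorus_act X lam Q \<delta> = (\<lambda>m\<in>M_space X lam Q.
     the_elem {N_orbit X Q (torus_act t z) | t z. t \<in> carrier torus \<and> torus_proj X Q t = \<delta> \<and> z \<in> m})"

definition pi_star ::
  "('d::finite \<Rightarrow> 'v::euclidean_space) \<Rightarrow> ('v \<Rightarrow>\<^sub>L real) \<Rightarrow> ((real ^ 'd) \<Rightarrow>\<^sub>L real)" where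
  "pi_star X \<mu> = \<mu> o\<^sub>L proj X"

definition Phi ::
  "('d::finite \<Rightarrow> 'v::euclidean_space) \<Rightarrow> ('d \<Rightarrow> real) \<Rightarrow> (complex ^ 'd) set \<Rightarrow> ('v \<Rightarrow>\<^sub>L real)" where
  "Phi X lam m = the_elem ((\<lambda>z. the_inv (pi_star X) (Upsilon lam z)) ` m)"

end

theory Submission
  imports Defs
begin

text \<open>
  Write \<open>\<pi>\<close> for the projection \<open>\<real>\<^sup>d \<rightarrow> \<dd>\<close> and \<open>rot x\<close> for the action of \<open>exp x\<close> on \<open>\<complex>\<^sup>d\<close>.  A point \<open>z\<close>
  lies in the zero level iff there is \<open>\<mu>\<close> with \<open>|z\<^sub>j|\<^sup>2 + \<lambda>\<^sub>j = \<langle>\<mu>, X\<^sub>j\<rangle>\<close> for all \<open>j\<close>; such a \<open>\<mu>\<close> lies in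
  \<open>\<Delta>\<close>, and every \<open>\<mu> \<in> \<Delta>\<close> arises by taking square roots.  Boundedness of \<open>\<Delta>\<close> therefore makes the
  zero level compact, and it also forces the \<open>X\<^sub>j\<close> to span \<open>\<dd>\<close>, so that \<open>\<pi>\<close> has a linear section.
  Both \<open>\<dd> \<rightarrow> \<dd>/Q\<close> and \<open>\<Psi>\<^sup>-\<^sup>1(0) \<rightarrow> M\<close> are quotients by group actions, hence open, so their
  product is again a quotient map and the continuity of the action can be tested upstairs, where
  the section gives an explicit formula.  The action is effective because it is free at the points
  over the interior of \<open>\<Delta>\<close>: there all \<open>z\<^sub>j\<close> are nonzero, and \<open>rot x z = rot y z\<close> forces \<open>x - y\<close> to be
  integral, hence \<open>\<pi> (x - y) \<in> Q\<close>.
\<close>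

section \<open>Quotient topologies\<close>

text \<open>The fibres of \<open>p\<close> are the orbits under the maps \<open>f a\<close>, so the
  saturation of an open \<open>U\<close> is the union of the preimages of \<open>U\<close> under
  these maps, each open by continuity.\<close>

lemma open_map_quot_topology:
  assumes cont: "\<And>a. a \<in> A \<Longrightarrow> continuous_map T T (f a)"
    and fibre: "\<And>x y. x \<in> topspace T \<Longrightarrow> y \<in> topspace T \<Longrightarrow> p x = p y \<longleftrightarrow> (\<exists>a\<in>A. f a x = y)"
  shows "open_map T (quot_topology T p) p"
  unfolding open_map_def
proof (intro allI impI)
  fix U assume U: "openin T U"
  then have sub: "U \<subseteq> topspace T" by (rule openin_subset)
  have "{x \<in> topspace T. p x \<in> p ` U} = (\<Union>a\<in>A. {x \<in> topspace T. f a x \<in> U})"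
  proof (intro Set.set_eqI iffI)
    fix x assume "x \<in> {x \<in> topspace T. p x \<in> p ` U}"
    then obtain u where "x \<in> topspace T" "u \<in> U" "p x = p u" by auto
    with fibre[of x u] sub show "x \<in> (\<Union>a\<in>A. {x \<in> topspace T. f a x \<in> U})" by auto
  next
    fix x assume "x \<in> (\<Union>a\<in>A. {x \<in> topspace T. f a x \<in> U})"
    then obtain a where "a \<in> A" "x \<in> topspace T" "f a x \<in> U" by auto
    with fibre[of x "f a x"] sub show "x \<in> {x \<in> topspace T. p x \<in> p ` U}" by auto
  qed
  moreover have "openin T {x \<in> topspace T. f a x \<in> U}" if "a \<in> A" for a
    using openin_continuous_map_preimage[OF cont[OF that] U] .
  ultimately show "openin (quot_topology T p) (p ` U)"
    using sub by (auto simp: openin_quot_topology)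
qed

lemma open_map_map_prod:
  assumes f: "open_map A A' f" and g: "open_map B B' g"
  shows "open_map (prod_topology A B) (prod_topology A' B') (map_prod f g)"
  unfolding open_map_def openin_prod_topology_alt
proof (intro allI impI)
  fix S x y
  assume S: "\<forall>x y. (x, y) \<in> S \<longrightarrow>
      (\<exists>U V. openin A U \<and> openin B V \<and> x \<in> U \<and> y \<in> V \<and> U \<times> V \<subseteq> S)"
    and "(x, y) \<in> map_prod f g ` S"
  then obtain a b where ab: "(a, b) \<in> S" and xy: "x = f a" "y = g b" by auto
  from S[rule_format, OF ab] obtain U V
    where UV: "openin A U" "openin B V" "a \<in> U" "b \<in> V" "U \<times> V \<subseteq> S" by blast
  have "f ` U \<times> g ` V \<subseteq> map_prod f g ` S"
    using UV(5) by (auto intro!: rev_image_eqI)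
  moreover have "openin A' (f ` U)" "openin B' (g ` V)"
    using f g UV(1,2) by (auto simp: open_map_def)
  ultimately show "\<exists>U V. openin A' U \<and> openin B' V \<and> x \<in> U \<and> y \<in> V
      \<and> U \<times> V \<subseteq> map_prod f g ` S"
    using UV(3,4) xy by blast
qed

text \<open>Quotient maps are not stable under products in general; openness of both factors makes
  the product an open continuous surjection, hence a quotient map.\<close>

lemma quotient_map_map_prod:
  assumes f: "quotient_map A A' f" "open_map A A' f"
    and g: "quotient_map B B' g" "open_map B B' g"
  shows "quotient_map (prod_topology A B) (prod_topology A' B') (map_prod f g)"
proof (rule continuous_open_imp_quotient_map)
  show "continuous_map (prod_topology A B) (prod_topology A' B') (map_prod f g)"
    unfolding map_prod_def case_prod_unfold
    by (intro continuous_map_pairedI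
        continuous_map_compose[OF continuous_map_fst quotient_imp_continuous_map[OF f(1)], unfolded o_def]
        continuous_map_compose[OF continuous_map_snd quotient_imp_continuous_map[OF g(1)], unfolded o_def])
  show "map_prod f g ` topspace (prod_topology A B) = topspace (prod_topology A' B')"
    using quotient_imp_surjective_map[OF f(1)] quotient_imp_surjective_map[OF g(1)]
    by (simp add: map_prod_surj_on)
qed (intro open_map_map_prod f g)

section \<open>Quotients of the additive group of a vector space\<close>

lemma vec_group_simps [simp]:
  "carrier vec_group = UNIV" "x \<otimes>\<^bsub>vec_group\<^esub> y = x + y" "\<one>\<^bsub>vec_group\<^esub> = 0"
  by (simp_all add: vec_group_def)

lemma comm_group_vec_group: "comm_group (vec_group :: 'a::ab_group_add monoid)"
proof (rule comm_groupI)
  fix x :: 'a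
  show "\<exists>y\<in>carrier vec_group. y \<otimes>\<^bsub>vec_group\<^esub> x = \<one>\<^bsub>vec_group\<^esub>"
    by (auto intro: exI[of _ "- x"])
qed (auto simp: algebra_simps)

lemma inv_vec_group [simp]: "inv\<^bsub>vec_group\<^esub> x = - x"
  by (rule group.inv_equality) (use comm_group_vec_group in \<open>auto simp: comm_group_def\<close>)

lemma subgroup_vec_groupI:
  assumes "0 \<in> H" and diff: "\<And>x y. x \<in> H \<Longrightarrow> y \<in> H \<Longrightarrow> x - y \<in> H"
  shows "subgroup H vec_group"
proof
  have minus: "- x \<in> H" if "x \<in> H" for x using diff[OF assms(1) that] by simp
  then show "\<And>x. x \<in> H \<Longrightarrow> inv\<^bsub>vec_group\<^esub> x \<in> H" by simp
  show "\<And>x y. x \<in> H \<Longrightarrow> y \<in> H \<Longrightarrow> x \<otimes>\<^bsub>vec_group\<^esub> y \<in> H"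
    using diff minus by fastforce
qed (use assms in auto)

lemma subgroup_vec_groupD:
  assumes "subgroup H vec_group"
  shows "0 \<in> H" "x \<in> H \<Longrightarrow> y \<in> H \<Longrightarrow> x + y \<in> H" "x \<in> H \<Longrightarrow> - x \<in> H"
    "x \<in> H \<Longrightarrow> y \<in> H \<Longrightarrow> x - y \<in> H"
proof -
  show "0 \<in> H" using subgroup.one_closed[OF assms] by simp
  show add: "x + y \<in> H" if "x \<in> H" "y \<in> H" for x y
    using subgroup.m_closed[OF assms that] by simp
  show minus: "- x \<in> H" if "x \<in> H" for x
    using subgroup.m_inv_closed[OF assms that] by simp
  show "x - y \<in> H" if "x \<in> H" "y \<in> H"
    using add[OF that(1) minus[OF that(2)]] by simp
qed

lemma vec_group_coset: "H #>\<^bsub>vec_group\<^esub> x = (\<lambda>h. h + x) ` H"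
  by (auto simp: r_coset_def)

lemma vec_group_coset_eq_iff:
  assumes "subgroup H vec_group"
  shows "H #>\<^bsub>vec_group\<^esub> x = H #>\<^bsub>vec_group\<^esub> y \<longleftrightarrow> x - y \<in> H"
proof
  assume "H #>\<^bsub>vec_group\<^esub> x = H #>\<^bsub>vec_group\<^esub> y"
  moreover have "x \<in> H #>\<^bsub>vec_group\<^esub> x"
    using subgroup_vec_groupD(1)[OF assms] by (auto simp: vec_group_coset intro: rev_image_eqI)
  ultimately show "x - y \<in> H" by (auto simp: vec_group_coset)
next
  assume xy: "x - y \<in> H"
  have "x \<in> H #>\<^bsub>vec_group\<^esub> y"
    unfolding vec_group_coset by (rule rev_image_eqI[OF xy]) simp
  then show "H #>\<^bsub>vec_group\<^esub> x = H #>\<^bsub>vec_group\<^esub> y"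
    by (intro group.repr_independence[symmetric] comm_group.axioms(2)[OF comm_group_vec_group] assms)
      simp_all
qed

lemma normal_vec_group:
  assumes "subgroup H vec_group"
  shows "H \<lhd> vec_group"
  by (rule comm_group.subgroup_imp_normal[OF comm_group_vec_group assms])

lemma carrier_vec_group_Mod: "carrier (vec_group Mod H) = range (\<lambda>x. H #>\<^bsub>vec_group\<^esub> x)"
  by (auto simp: FactGroup_def RCOSETS_def)

lemma subgroup_quasilattice:
  assumes "quasilattice Q"
  shows "subgroup Q vec_group"
proof -
  obtain S where Q: "Q = {\<Sum>s\<in>S. of_int (c s) *\<^sub>R s | c :: 'a \<Rightarrow> int. True}"
    using assms unfolding quasilattice_def by blast
  show ?thesis
  proof (rule subgroup_vec_groupI)
    show "0 \<in> Q" unfolding Q by (auto intro!: exI[of _ "\<lambda>_. 0"])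
    fix x y assume "x \<in> Q" "y \<in> Q"
    then obtain c c' :: "'a \<Rightarrow> int" where
      "x = (\<Sum>s\<in>S. of_int (c s) *\<^sub>R s)" "y = (\<Sum>s\<in>S. of_int (c' s) *\<^sub>R s)"
      unfolding Q by auto
    then have "x - y = (\<Sum>s\<in>S. of_int (c s - c' s) *\<^sub>R s)"
      by (simp add: sum_subtractf scaleR_diff_left)
    then show "x - y \<in> Q"
      unfolding Q by (simp only: mem_Collect_eq) (rule exI[of _ "\<lambda>s. c s - c' s"], simp)
  qed
qed

lemma subgroup_of_int_scaleR:
  fixes x :: "'a::real_vector"
  assumes H: "subgroup H vec_group" and "x \<in> H"
  shows "of_int k *\<^sub>R x \<in> H"
proof -
  have nat: "of_nat n *\<^sub>R x \<in> H" for n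
    by (induction n) (auto simp: scaleR_left_distrib intro: subgroup_vec_groupD[OF H] assms(2))
  show ?thesis
    by (cases k rule: int_cases2) (use nat subgroup_vec_groupD(3)[OF H] in auto)
qed

lemma subgroup_sum:
  assumes H: "subgroup H vec_group" and "\<And>j. j \<in> A \<Longrightarrow> f j \<in> H"
  shows "sum f A \<in> H"
  using assms(2)
  by (induction A rule: infinite_finite_induct) (auto intro: subgroup_vec_groupD[OF H])

lemma subgroup_int_lattice: "subgroup int_lattice vec_group"
  by (rule subgroup_vec_groupI) (auto simp: int_lattice_def)

section \<open>Rotations\<close>

text \<open>The torus action pulled back along \<open>exp\<close>, so that calculations use vectors
  rather than cosets and \<open>the_elem\<close>.\<close>

definition rot :: "real ^ 'd \<Rightarrow> complex ^ 'd \<Rightarrow> complex ^ 'd::finite" where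
  "rot x z = (\<chi> j. exp (2 * of_real pi * \<i> * of_real (x $ j)) * z $ j)"

lemma rot_nth: "rot x z $ j = exp (2 * of_real pi * \<i> * of_real (x $ j)) * z $ j"
  by (simp add: rot_def)

lemma rot_add: "rot (x + y) z = rot x (rot y z)"
  by (simp add: vec_eq_iff rot_nth exp_add distrib_left)

lemma rot_0 [simp]: "rot 0 z = z"
  by (simp add: vec_eq_iff rot_nth)

lemma cmod_rot [simp]: "cmod (rot x z $ j) = cmod (z $ j)"
  by (simp add: rot_nth norm_mult)

lemma exp_2pi_i_eq_1: "exp (2 * of_real pi * \<i> * of_real t) = 1 \<longleftrightarrow> t \<in> \<int>"
proof -
  have "(2 * pi * t = of_int (2 * n) * pi) \<longleftrightarrow> t = of_int n" for n
    by auto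
  then show ?thesis by (auto simp: exp_eq_1 Ints_def)
qed

lemma rot_int_lattice: "x \<in> int_lattice \<Longrightarrow> rot x z = z"
  by (simp add: vec_eq_iff rot_nth int_lattice_def exp_2pi_i_eq_1)

lemma rot_fixes_generic:
  assumes "rot x z = z" "\<And>j. z $ j \<noteq> 0"
  shows "x \<in> int_lattice"
  using assms by (auto simp: vec_eq_iff rot_nth int_lattice_def exp_2pi_i_eq_1)

lemma continuous_on_rot [continuous_intros]:
  fixes f :: "'a::topological_space \<Rightarrow> real ^ 'd::finite"
  assumes "continuous_on S f" "continuous_on S g"
  shows "continuous_on S (\<lambda>p. rot (f p) (g p))"
  unfolding rot_def using assms by (intro continuous_intros)

text \<open>Integral vectors rotate trivially, so the formula in \<open>torus_act\<close> is
  constant on each coset and \<open>the_elem\<close> may be evaluated at \<open>x\<close>.\<close>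

lemma torus_act_coset: "torus_act (int_lattice #>\<^bsub>vec_group\<^esub> x) z = rot x z"
  unfolding torus_act_def rot_def[symmetric] vec_group_coset
  by (rule the_elem_image_unique)
    (use subgroup_vec_groupD(1)[OF subgroup_int_lattice] in \<open>auto simp: rot_add rot_int_lattice\<close>)

lemma proj_axis: "proj X (axis j 1) = X j"
proof -
  have "proj X (axis j 1) = (\<Sum>i\<in>UNIV. if i = j then X i else 0)"
    unfolding proj_apply by (rule sum.cong) (auto simp: axis_def)
  then show ?thesis by simp
qed

lemma carrier_torus: "carrier torus = range (\<lambda>x. int_lattice #>\<^bsub>vec_group\<^esub> x)"
  by (simp add: torus_def carrier_vec_group_Mod)

section \<open>The action on the quotient\<close>

lemma Upsilon_rot [simp]: "Upsilon lam (rot x z) = Upsilon lam z"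
  by (simp add: Upsilon_def)

lemma rot_mem_zero_level [simp]: "rot x z \<in> zero_level X lam \<longleftrightarrow> z \<in> zero_level X lam"
  by (simp add: zero_level_def Psi_def)

text \<open>Collects what makes the quotient constructions well defined: the subgroup property
  compares cosets by differences, and containing the normals makes \<open>proj X\<close> carry
  \<open>int_lattice\<close> into \<open>Q\<close>.\<close>

locale quasitorus_setting =
  fixes X :: "'d::finite \<Rightarrow> 'v::euclidean_space" and Q :: "'v set"
  assumes subgroup_Q: "subgroup Q vec_group" and normals_in_Q: "range X \<subseteq> Q"
begin

lemmas Q_closed = subgroup_vec_groupD[OF subgroup_Q]

lemma quasitorus_proj_eq_iff: "quasitorus_proj Q x = quasitorus_proj Q y \<longleftrightarrow> x - y \<in> Q"
  by (simp add: quasitorus_proj_def vec_group_coset_eq_iff[OF subgroup_Q])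

lemma proj_int_lattice:
  assumes "x \<in> int_lattice"
  shows "proj X x \<in> Q"
  unfolding proj_apply
proof (rule subgroup_sum[OF subgroup_Q])
  fix j
  from assms obtain k where "x $ j = of_int k" by (auto simp: int_lattice_def Ints_def)
  then show "x $ j *\<^sub>R X j \<in> Q"
    using subgroup_of_int_scaleR[OF subgroup_Q, of "X j" k] normals_in_Q by auto
qed

lemma torus_proj_coset:
  "torus_proj X Q (int_lattice #>\<^bsub>vec_group\<^esub> x) = quasitorus_proj Q (proj X x)"
  unfolding torus_proj_def vec_group_coset
proof (rule the_elem_image_unique)
  fix y assume "y \<in> (\<lambda>h. h + x) ` int_lattice"
  then show "quasitorus_proj Q (proj X y) = quasitorus_proj Q (proj X x)"
    by (auto simp: quasitorus_proj_eq_iff blinfun.add_right proj_int_lattice)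
qed (use subgroup_vec_groupD(1)[OF subgroup_int_lattice] in auto)

lemma N_orbit_eq: "N_orbit X Q z = {rot x z | x. proj X x \<in> Q}"
proof -
  \<comment> \<open>The neutral element of the quotient is the coset \<open>Q\<close> itself, so
    \<open>N\<close> consists of the classes of the vectors that project into
    \<open>Q\<close>.\<close>
  have "Q = quasitorus_proj Q 0"
    by (auto simp: quasitorus_proj_def vec_group_coset)
  then have "torus_proj X Q (int_lattice #>\<^bsub>vec_group\<^esub> x) = Q \<longleftrightarrow> proj X x \<in> Q" for x
    using quasitorus_proj_eq_iff[of "proj X x" 0] by (simp add: torus_proj_coset)
  then have "carrier (N_group X Q) =
      (\<lambda>x. int_lattice #>\<^bsub>vec_group\<^esub> x) ` {x. proj X x \<in> Q}"
    by (auto simp: N_group_def kernel_def carrier_torus quasitorus_def)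
  then have "N_orbit X Q z =
      (\<lambda>t. torus_act t z) ` (\<lambda>x. int_lattice #>\<^bsub>vec_group\<^esub> x) ` {x. proj X x \<in> Q}"
    unfolding N_orbit_def orbit_def by blast
  then show ?thesis by (auto simp: image_image torus_act_coset)
qed

lemma N_orbit_eq_iff: "N_orbit X Q z = N_orbit X Q w \<longleftrightarrow> (\<exists>x. proj X x \<in> Q \<and> rot x z = w)"
proof
  have "w \<in> N_orbit X Q w"
    by (auto simp: N_orbit_eq intro!: exI[of _ 0] Q_closed(1))
  moreover assume "N_orbit X Q z = N_orbit X Q w"
  ultimately have "w \<in> N_orbit X Q z" by simp
  then show "\<exists>x. proj X x \<in> Q \<and> rot x z = w" by (auto simp: N_orbit_eq)
next
  \<comment> \<open>One inclusion suffices: applied to \<open>- x\<close> it gives the reverse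
    one.\<close>
  have sub: "N_orbit X Q (rot x u) \<subseteq> N_orbit X Q u" if "proj X x \<in> Q" for x u
    using that by (auto simp: N_orbit_eq rot_add[symmetric] blinfun.add_right Q_closed(2))
  assume "\<exists>x. proj X x \<in> Q \<and> rot x z = w"
  then obtain x where x: "proj X x \<in> Q" "rot x z = w" by blast
  from x have "rot (- x) w = z" by (metis rot_add rot_0 add.left_inverse)
  then have "N_orbit X Q z \<subseteq> N_orbit X Q w"
    using sub[of "- x" w] x(1) by (simp add: blinfun.minus_right Q_closed(3))
  then show "N_orbit X Q z = N_orbit X Q w" using sub[OF x(1), of z] x(2) by simp
qed

text \<open>Independence of the induced action from the torus representative and from the point of
  the orbit, both at once.\<close>

lemma N_orbit_rot_eq:
  assumes "proj X x - proj X y \<in> Q" "N_orbit X Q z = N_orbit X Q w"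
  shows "N_orbit X Q (rot x z) = N_orbit X Q (rot y w)"
proof -
  obtain u where u: "proj X u \<in> Q" "rot u z = w" using assms(2) N_orbit_eq_iff by blast
  \<comment> \<open>Rotations commute, so a single vector undoes \<open>x\<close>, carries
    \<open>z\<close> to \<open>w\<close> by \<open>u\<close> and then applies
    \<open>y\<close>.\<close>
  have "rot (y + u - x) (rot x z) = rot y w"
    by (simp add: rot_add[symmetric] flip: u(2))
  moreover have "proj X (y + u - x) \<in> Q"
    using Q_closed(4)[OF u(1) assms(1)]
    by (simp add: blinfun.add_right blinfun.diff_right algebra_simps)
  ultimately show ?thesis using N_orbit_eq_iff by blast
qed

lemma M_space_eq: "M_space X lam Q = N_orbit X Q ` zero_level X lam"
  by (auto simp: M_space_def orbits_def N_orbit_def)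

text \<open>By \<open>N_orbit_rot_eq\<close> all representatives yield the same orbit, so the set
  under \<open>the_elem\<close> in \<open>quasitorus_act\<close> is a singleton.\<close>

lemma quasitorus_act_N_orbit:
  assumes "z \<in> zero_level X lam"
  shows "quasitorus_act X lam Q (quasitorus_proj Q (proj X x)) (N_orbit X Q z)
    = N_orbit X Q (rot x z)"
proof -
  let ?S = "{N_orbit X Q (torus_act t w) | t w. t \<in> carrier torus \<and>
      torus_proj X Q t = quasitorus_proj Q (proj X x) \<and> w \<in> N_orbit X Q z}"
  have z: "z \<in> N_orbit X Q z"
    by (auto simp: N_orbit_eq intro!: exI[of _ 0] Q_closed(1))
  have "?S = {N_orbit X Q (rot x z)}"
  proof (intro equalityI subsetI)
    fix m assume "m \<in> ?S"
    then obtain y w where m: "m = N_orbit X Q (rot y w)"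
      and y: "quasitorus_proj Q (proj X y) = quasitorus_proj Q (proj X x)"
      and w: "w \<in> N_orbit X Q z"
      by (auto simp: carrier_torus torus_proj_coset torus_act_coset)
    from w have "N_orbit X Q z = N_orbit X Q w"
      unfolding N_orbit_eq_iff by (auto simp: N_orbit_eq)
    with N_orbit_rot_eq[of y x w z] y show "m \<in> {N_orbit X Q (rot x z)}"
      by (simp add: m quasitorus_proj_eq_iff)
  next
    fix m assume "m \<in> {N_orbit X Q (rot x z)}"
    then have "m = N_orbit X Q (torus_act (int_lattice #>\<^bsub>vec_group\<^esub> x) z)"
      by (simp add: torus_act_coset)
    moreover have "int_lattice #>\<^bsub>vec_group\<^esub> x \<in> carrier torus" by (simp add: carrier_torus)
    ultimately show "m \<in> ?S" using z torus_proj_coset[of x] by blast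
  qed
  then show ?thesis
    using assms by (simp add: quasitorus_act_def M_space_eq)
qed

lemma quasitorus_act_torus:
  assumes "t \<in> carrier torus" "z \<in> zero_level X lam"
  shows "quasitorus_act X lam Q (torus_proj X Q t) (N_orbit X Q z) = N_orbit X Q (torus_act t z)"
  using assms
  by (auto simp: carrier_torus torus_proj_coset torus_act_coset quasitorus_act_N_orbit)

end

section \<open>Faithfulness, continuity and the moment map\<close>

locale surjective_quasitorus_setting = quasitorus_setting X Q
  for X :: "'d::finite \<Rightarrow> 'v::euclidean_space" and Q +
  assumes surj_proj: "surj (blinfun_apply (proj X))"
begin

lemma proj_section_exists: "\<exists>g :: 'v \<Rightarrow>\<^sub>L (real ^ 'd). \<forall>v. proj X (blinfun_apply g v) = v"
proof -
  have "linear (blinfun_apply (proj X))"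
    by (simp add: bounded_linear.linear blinfun.bounded_linear_right)
  from linear_surjective_right_inverse[OF this surj_proj]
  obtain g where g: "linear g" "blinfun_apply (proj X) \<circ> g = id" by blast
  then have "blinfun_apply (proj X) (Blinfun g v) = v" for v
    by (simp add: bounded_linear_Blinfun_apply linear_conv_bounded_linear[symmetric])
      (metis comp_apply id_apply)
  then show ?thesis by blast
qed

text \<open>An arbitrary right inverse of \<pi>, but a bounded linear one: linearity turns sums in
  the quasitorus into compositions of rotations, and boundedness yields continuity of the action and
  of \<open>Phi\<close>.\<close>

definition sec :: "'v \<Rightarrow>\<^sub>L (real ^ 'd)" where
  "sec = (SOME g. \<forall>v. proj X (blinfun_apply g v) = v)"

lemma proj_sec [simp]: "proj X (sec v) = v"
  using someI_ex[OF proj_section_exists] by (simp add: sec_def)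

section \<open>The group action on the orbit space and its effectiveness\<close>

lemma quasitorus_act_proj:
  assumes "z \<in> zero_level X lam"
  shows "quasitorus_act X lam Q (quasitorus_proj Q v) (N_orbit X Q z)
    = N_orbit X Q (rot (sec v) z)"
  using quasitorus_act_N_orbit[OF assms, of "sec v"] by simp

lemma carrier_quasitorus: "carrier (quasitorus Q) = range (quasitorus_proj Q)"
  by (simp add: quasitorus_def quasitorus_proj_def carrier_vec_group_Mod)

lemma mult_quasitorus:
  "quasitorus_proj Q v \<otimes>\<^bsub>quasitorus Q\<^esub> quasitorus_proj Q w = quasitorus_proj Q (v + w)"
  using normal.rcos_sum[OF normal_vec_group[OF subgroup_Q], of v w]
  by (simp add: quasitorus_def quasitorus_proj_def)

lemma quasitorus_act_add:
  assumes m: "m \<in> M_space X lam Q"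
  shows "quasitorus_act X lam Q (quasitorus_proj Q (v + w)) m
    = quasitorus_act X lam Q (quasitorus_proj Q v) (quasitorus_act X lam Q (quasitorus_proj Q w) m)"
  using m
  by (auto simp: M_space_eq quasitorus_act_proj blinfun.add_right rot_add)

lemma quasitorus_act_0:
  assumes "m \<in> M_space X lam Q"
  shows "quasitorus_act X lam Q (quasitorus_proj Q 0) m = m"
  using assms by (auto simp: M_space_eq quasitorus_act_proj)

lemma quasitorus_act_closed:
  assumes "m \<in> M_space X lam Q"
  shows "quasitorus_act X lam Q (quasitorus_proj Q v) m \<in> M_space X lam Q"
  using assms by (auto simp: M_space_eq quasitorus_act_proj)

text \<open>The class of \<open>- v\<close> acts as the inverse.\<close>

lemma quasitorus_act_Bij:
  "quasitorus_act X lam Q (quasitorus_proj Q v) \<in> Bij (M_space X lam Q)"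
proof -
  have "bij_betw (quasitorus_act X lam Q (quasitorus_proj Q v)) (M_space X lam Q) (M_space X lam Q)"
    by (rule bij_betw_byWitness[where f' = "quasitorus_act X lam Q (quasitorus_proj Q (- v))"])
      (auto simp: quasitorus_act_add[symmetric] quasitorus_act_0 quasitorus_act_closed)
  then show ?thesis by (simp add: Bij_def quasitorus_act_def)
qed

lemma group_action_quasitorus:
  "group_action (quasitorus Q) (M_space X lam Q) (quasitorus_act X lam Q)"
proof -
  let ?M = "M_space X lam Q" and ?\<phi> = "quasitorus_act X lam Q"
  have "?\<phi> \<in> hom (quasitorus Q) (BijGroup ?M)"
  proof (rule homI)
    fix a b assume "a \<in> carrier (quasitorus Q)" "b \<in> carrier (quasitorus Q)"
    then obtain v w where ab: "a = quasitorus_proj Q v" "b = quasitorus_proj Q w"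
      by (auto simp: carrier_quasitorus)
    have "?\<phi> (quasitorus_proj Q (v + w)) =
        compose ?M (?\<phi> (quasitorus_proj Q v)) (?\<phi> (quasitorus_proj Q w))"
      \<comment> \<open>Both sides are extensional on \<open>?M\<close>, so they need only agree at
        its points.\<close>
      using Bij_imp_extensional[OF quasitorus_act_Bij]
      by (intro extensionalityI[of _ ?M]) (auto simp: quasitorus_act_add compose_eq)
    then show "?\<phi> (a \<otimes>\<^bsub>quasitorus Q\<^esub> b) = ?\<phi> a \<otimes>\<^bsub>BijGroup ?M\<^esub> ?\<phi> b"
      by (simp add: ab mult_quasitorus BijGroup_def quasitorus_act_Bij)
  qed (auto simp: carrier_quasitorus BijGroup_def quasitorus_act_Bij)
  moreover have "group (quasitorus Q)"
    unfolding quasitorus_def by (rule normal.factorgroup_is_group[OF normal_vec_group[OF subgroup_Q]])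
  ultimately show ?thesis
    by (intro group_action.intro group_hom.intro group_hom_axioms.intro group_BijGroup)
qed

text \<open>A single orbit on which the action is free already separates the elements of the
  quasitorus.\<close>

lemma faithful_action_quasitorus:
  assumes z: "z \<in> zero_level X lam" "\<And>j. z $ j \<noteq> 0"
  shows "faithful_action (quasitorus Q) (M_space X lam Q) (quasitorus_act X lam Q)"
proof -
  have "inj_on (quasitorus_act X lam Q) (carrier (quasitorus Q))"
  proof (rule inj_onI)
    fix a b assume "a \<in> carrier (quasitorus Q)" "b \<in> carrier (quasitorus Q)"
      and eq: "quasitorus_act X lam Q a = quasitorus_act X lam Q b"
    then obtain v w where ab: "a = quasitorus_proj Q v" "b = quasitorus_proj Q w"
      by (auto simp: carrier_quasitorus)
    from eq have "N_orbit X Q (rot (sec v) z) = N_orbit X Q (rot (sec w) z)"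
      unfolding ab by (metis quasitorus_act_proj[OF z(1)])
    then obtain x where x: "proj X x \<in> Q" "rot x (rot (sec v) z) = rot (sec w) z"
      using N_orbit_eq_iff by blast
    \<comment> \<open>Both sides are rotated back by \<open>sec w\<close>, which leaves one rotation
      fixing \<open>z\<close>; as \<open>z\<close> has no zero coordinate, its vector is
      integral.\<close>
    then have "rot (- sec w + (x + sec v)) z = rot (- sec w + sec w) z"
      by (simp only: rot_add)
    then have "- sec w + (x + sec v) \<in> int_lattice"
      by (intro rot_fixes_generic[OF _ z(2)]) simp
    then have "proj X (- sec w + (x + sec v)) \<in> Q" by (rule proj_int_lattice)
    \<comment> \<open>This difference is \<open>v - w\<close>.\<close>
    with x(1) have "proj X (- sec w + (x + sec v)) - proj X x \<in> Q" by (intro Q_closed)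
    then show "a = b"
      by (simp add: ab quasitorus_proj_eq_iff blinfun.add_right blinfun.diff_right)
  qed
  then show ?thesis
    by (intro faithful_action.intro faithful_action_axioms.intro group_action_quasitorus)
qed

section \<open>Open quotient maps and continuity of the action\<close>

lemma quotient_map_quasitorus_proj:
  "quotient_map euclidean (quasitorus_topology Q) (quasitorus_proj Q)"
  "open_map euclidean (quasitorus_topology Q) (quasitorus_proj Q)"
proof -
  show "quotient_map euclidean (quasitorus_topology Q) (quasitorus_proj Q)"
    unfolding quasitorus_topology_def by (rule quotient_map_quot_topology)
  show "open_map euclidean (quasitorus_topology Q) (quasitorus_proj Q)"
    unfolding quasitorus_topology_def
  proof (rule open_map_quot_topology[where f = "(+)" and A = Q])
    fix x y :: 'v
    have "x - y \<in> Q \<longleftrightarrow> y - x \<in> Q" using Q_closed(3) by fastforce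
    also have "\<dots> \<longleftrightarrow> (\<exists>a\<in>Q. a + x = y)" by (metis add_diff_cancel diff_add_cancel)
    finally show "quasitorus_proj Q x = quasitorus_proj Q y \<longleftrightarrow> (\<exists>a\<in>Q. a + x = y)"
      by (simp add: quasitorus_proj_eq_iff)
  qed (auto intro!: continuous_intros)
qed

lemma quotient_map_N_orbit:
  "quotient_map (top_of_set (zero_level X lam)) (M_topology X lam Q) (N_orbit X Q)"
  "open_map (top_of_set (zero_level X lam)) (M_topology X lam Q) (N_orbit X Q)"
proof -
  show "quotient_map (top_of_set (zero_level X lam)) (M_topology X lam Q) (N_orbit X Q)"
    unfolding M_topology_def by (rule quotient_map_quot_topology)
  show "open_map (top_of_set (zero_level X lam)) (M_topology X lam Q) (N_orbit X Q)"
    unfolding M_topology_def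
    by (rule open_map_quot_topology[where f = rot and A = "{x. proj X x \<in> Q}"])
      (auto simp: N_orbit_eq_iff intro!: continuous_intros)
qed

lemma continuous_map_quasitorus_act:
  "continuous_map (prod_topology (quasitorus_topology Q) (M_topology X lam Q))
     (M_topology X lam Q) (\<lambda>(\<delta>, m). quasitorus_act X lam Q \<delta> m)"
proof (rule continuous_compose_quotient_map)
  let ?Z = "zero_level X lam"
  let ?P = "prod_topology euclidean (top_of_set ?Z)"
  show "quotient_map ?P (prod_topology (quasitorus_topology Q) (M_topology X lam Q))
      (map_prod (quasitorus_proj Q) (N_orbit X Q))"
    by (intro quotient_map_map_prod quotient_map_quasitorus_proj quotient_map_N_orbit)
  have P: "?P = top_of_set (UNIV \<times> ?Z)"
    by (metis prod_topology_subtopology_eu subtopology_UNIV)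
  \<comment> \<open>This is the action lifted to vectors and points of the zero level; it is jointly
    continuous because \<open>sec\<close> is continuous.\<close>
  have "continuous_map ?P (top_of_set ?Z) (\<lambda>p. rot (sec (fst p)) (snd p))"
    unfolding P by (auto intro!: continuous_intros)
  from continuous_map_compose[OF this quotient_imp_continuous_map[OF quotient_map_N_orbit(1)]]
  show "continuous_map ?P (M_topology X lam Q)
      ((\<lambda>(\<delta>, m). quasitorus_act X lam Q \<delta> m) \<circ> map_prod (quasitorus_proj Q) (N_orbit X Q))"
    by (rule continuous_map_eq) (auto simp: quasitorus_act_proj)
qed

section \<open>The moment map and its image\<close>

lemma Upsilon_apply: "Upsilon lam z x = (\<Sum>j\<in>UNIV. ((cmod (z $ j))\<^sup>2 + lam j) * x $ j)"
  by (simp add: Upsilon_def blinfun.sum_left blinfun.scaleR_left dual_basis_apply)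

lemma pi_star_apply: "pi_star X \<mu> x = \<mu> (proj X x)"
  by (simp add: pi_star_def)

text \<open>Two functionals on R^d agree iff they agree on the standard basis, which
  \<open>proj X\<close> sends to the normals. This links the zero level to the half spaces: the
  squared moduli are the slacks of the inequalities.\<close>

lemma pi_star_eq_Upsilon_iff:
  "pi_star X \<mu> = Upsilon lam z \<longleftrightarrow> (\<forall>j. \<mu> (X j) = (cmod (z $ j))\<^sup>2 + lam j)"
proof
  assume eq: "pi_star X \<mu> = Upsilon lam z"
  show "\<forall>j. \<mu> (X j) = (cmod (z $ j))\<^sup>2 + lam j"
  proof
    fix j
    have "\<mu> (X j) = Upsilon lam z (axis j 1)"
      by (simp add: eq[symmetric] pi_star_apply proj_axis)
    also have "\<dots> = (\<Sum>i\<in>UNIV. if i = j then (cmod (z $ i))\<^sup>2 + lam i else 0)"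
      unfolding Upsilon_apply by (rule sum.cong) (auto simp: axis_def)
    finally show "\<mu> (X j) = (cmod (z $ j))\<^sup>2 + lam j" by simp
  qed
next
  assume "\<forall>j. \<mu> (X j) = (cmod (z $ j))\<^sup>2 + lam j"
  then show "pi_star X \<mu> = Upsilon lam z"
    by (intro blinfun_eqI) (simp add: pi_star_apply Upsilon_apply proj_apply
        blinfun.sum_right blinfun.scaleR_right mult.commute)
qed

lemma inj_pi_star: "inj (pi_star X)"
proof (rule injI)
  fix \<mu> \<nu> assume "pi_star X \<mu> = pi_star X \<nu>"
  then have "\<mu> (proj X (sec v)) = \<nu> (proj X (sec v))" for v
    by (metis pi_star_apply)
  then show "\<mu> = \<nu>" by (intro blinfun_eqI) simp
qed

lemma zero_level_iff_vanishes:
  "z \<in> zero_level X lam \<longleftrightarrow> (\<forall>x\<in>n_space X. Upsilon lam z x = 0)"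
  by (auto simp: zero_level_def Psi_def iota_star_def restrict_def fun_eq_iff)

text \<open>Exactness of the dual sequence with an explicit preimage: a functional vanishing on the
  kernel of \<pi> factors through \<pi>, and composing it with \<open>sec\<close> gives the
  factor.\<close>

lemma pi_star_sec:
  assumes "z \<in> zero_level X lam"
  shows "pi_star X (Upsilon lam z o\<^sub>L sec) = Upsilon lam z"
proof (rule blinfun_eqI)
  fix x
  have "x - sec (proj X x) \<in> n_space X"
    by (simp add: n_space_def blinfun.diff_right)
  with assms have "Upsilon lam z (x - sec (proj X x)) = 0"
    by (simp add: zero_level_iff_vanishes)
  then show "pi_star X (Upsilon lam z o\<^sub>L sec) x = Upsilon lam z x"
    by (simp add: pi_star_apply blinfun.diff_right)
qed

lemma zero_level_iff:
  "z \<in> zero_level X lam \<longleftrightarrow> (\<exists>\<mu>. pi_star X \<mu> = Upsilon lam z)"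
proof
  assume "\<exists>\<mu>. pi_star X \<mu> = Upsilon lam z"
  then obtain \<mu> where \<mu>: "pi_star X \<mu> = Upsilon lam z" ..
  show "z \<in> zero_level X lam"
    unfolding zero_level_iff_vanishes \<mu>[symmetric]
    by (auto simp: pi_star_apply n_space_def)
qed (use pi_star_sec in blast)

lemma the_inv_pi_star: "pi_star X \<mu> = Upsilon lam z \<Longrightarrow> the_inv (pi_star X) (Upsilon lam z) = \<mu>"
  by (metis the_inv_f_f[OF inj_pi_star])

lemma Phi_N_orbit: "Phi X lam (N_orbit X Q z) = the_inv (pi_star X) (Upsilon lam z)"
  unfolding Phi_def
  by (rule the_elem_image_unique) (auto simp: N_orbit_eq intro!: exI[of _ 0] Q_closed(1))

lemma continuous_on_Upsilon: "continuous_on S (Upsilon lam)"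
  unfolding Upsilon_def by (intro continuous_intros)

lemma continuous_map_Phi: "continuous_map (M_topology X lam Q) euclidean (Phi X lam)"
proof (rule continuous_compose_quotient_map[OF quotient_map_N_orbit(1)])
  \<comment> \<open>On the zero level the inverse of \<open>pi_star X\<close> is composition with
    \<open>sec\<close>, a bounded linear operation, so continuity reduces to that of
    \<open>Upsilon lam\<close>.\<close>
  have "continuous_map (top_of_set (zero_level X lam)) euclidean (\<lambda>z. Upsilon lam z o\<^sub>L sec)"
    by (auto intro!: bounded_linear.continuous_on[OF
          bounded_bilinear.bounded_linear_left[OF bounded_bilinear_blinfun_compose]]
        continuous_on_Upsilon)
  then show "continuous_map (top_of_set (zero_level X lam)) euclidean (Phi X lam \<circ> N_orbit X Q)"
    by (rule continuous_map_eq) (simp add: Phi_N_orbit the_inv_pi_star[OF pi_star_sec])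
qed

lemma Phi_image:
  "Phi X lam ` M_space X lam Q = (\<Inter>j. {\<mu>. blinfun_apply \<mu> (X j) \<ge> lam j})" (is "_ = ?\<Delta>")
proof
  show "Phi X lam ` M_space X lam Q \<subseteq> ?\<Delta>"
  proof (clarsimp simp: M_space_eq Phi_N_orbit zero_level_iff)
    fix z \<mu> j assume \<mu>: "pi_star X \<mu> = Upsilon lam z"
    then show "lam j \<le> the_inv (pi_star X) (Upsilon lam z) (X j)"
      by (simp add: the_inv_pi_star[OF \<mu>] pi_star_eq_Upsilon_iff)
  qed
next
  show "?\<Delta> \<subseteq> Phi X lam ` M_space X lam Q"
  proof
    fix \<mu> assume \<mu>: "\<mu> \<in> ?\<Delta>"
    \<comment> \<open>The radicands are nonnegative because \<mu> satisfies all the inequalities, so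
      the squared moduli of \<open>z\<close> are exactly the slacks.\<close>
    define z :: "complex ^ 'd" where "z = (\<chi> j. of_real (sqrt (\<mu> (X j) - lam j)))"
    have "pi_star X \<mu> = Upsilon lam z"
      using \<mu> by (simp add: pi_star_eq_Upsilon_iff z_def)
    then have "z \<in> zero_level X lam" "\<mu> = Phi X lam (N_orbit X Q z)"
      by (auto simp: zero_level_iff Phi_N_orbit the_inv_pi_star)
    then show "\<mu> \<in> Phi X lam ` M_space X lam Q"
      by (auto simp: M_space_eq)
  qed
qed

section \<open>Compactness\<close>

lemma compact_zero_level:
  assumes "bounded (\<Inter>j. {\<mu>. blinfun_apply \<mu> (X j) \<ge> lam j})"
  shows "compact (zero_level X lam)"
proof -
  obtain B where B: "\<And>\<mu> :: 'v \<Rightarrow>\<^sub>L real. (\<forall>j. blinfun_apply \<mu> (X j) \<ge> lam j) \<Longrightarrow> norm \<mu> \<le> B"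
    using assms unfolding bounded_iff INT_iff mem_Collect_eq Ball_def by auto
  have "norm z \<le> (\<Sum>j\<in>UNIV. 1 + (B * norm (X j) - lam j))" if z: "z \<in> zero_level X lam" for z
  proof -
    obtain \<mu> :: "'v \<Rightarrow>\<^sub>L real" where \<mu>: "\<And>j. \<mu> (X j) = (cmod (z $ j))\<^sup>2 + lam j"
      using z unfolding zero_level_iff pi_star_eq_Upsilon_iff by blast
    have "norm \<mu> \<le> B" by (rule B) (simp add: \<mu>)
    \<comment> \<open>The summand 1 avoids a square root: a modulus of at least 1 is bounded by its
      square, and a smaller one by 1, while the remaining term bounds a square and so is
      nonnegative.\<close>
    have "norm (z $ j) \<le> 1 + (B * norm (X j) - lam j)" for j
    proof -
      have "(cmod (z $ j))\<^sup>2 + lam j \<le> norm \<mu> * norm (X j)"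
        using norm_blinfun[of \<mu> "X j"] \<mu>[of j] by simp
      also have "\<dots> \<le> B * norm (X j)"
        using \<open>norm \<mu> \<le> B\<close> by (rule mult_right_mono) simp
      finally show ?thesis
        using self_le_power[of "cmod (z $ j)" 2] zero_le_power2[of "cmod (z $ j)"]
        by (cases "cmod (z $ j) \<ge> 1") linarith+
    qed
    then have "(\<Sum>j\<in>UNIV. norm (z $ j)) \<le> (\<Sum>j\<in>UNIV. 1 + (B * norm (X j) - lam j))"
      by (intro sum_mono) simp
    moreover have "norm z \<le> (\<Sum>j\<in>UNIV. norm (z $ j))"
      unfolding norm_vec_def by (rule L2_set_le_sum) simp
    ultimately show ?thesis by linarith
  qed
  then have "bounded (zero_level X lam)" unfolding bounded_iff by blast
  moreover have "zero_level X lam = (\<Inter>x\<in>n_space X. {z. Upsilon lam z x = 0})"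
    by (auto simp: zero_level_iff_vanishes)
  moreover have "closed {z. Upsilon lam z x = 0}" for x
    unfolding Upsilon_apply by (intro closed_Collect_eq continuous_intros)
  ultimately show ?thesis by (simp add: compact_eq_bounded_closed closed_INT)
qed

lemma compact_space_M:
  assumes "bounded (\<Inter>j. {\<mu>. blinfun_apply \<mu> (X j) \<ge> lam j})"
  shows "compact_space (M_topology X lam Q)"
proof -
  have "compactin (top_of_set (zero_level X lam)) (zero_level X lam)"
    using compact_zero_level[OF assms] by (simp add: compactin_subtopology)
  from image_compactin[OF this quotient_imp_continuous_map[OF quotient_map_N_orbit(1)]]
  show ?thesis by (simp add: compact_space_def topspace_M_topology M_space_eq)
qed

text \<open>Strict inequalities make all the square roots positive; the point supplies the free
  orbit for \<open>faithful_action_quasitorus\<close>.\<close>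

lemma zero_level_generic_point:
  fixes \<mu> :: "'v \<Rightarrow>\<^sub>L real"
  assumes "\<And>j. \<mu> (X j) > lam j"
  obtains z where "z \<in> zero_level X lam" "\<And>j. z $ j \<noteq> 0"
proof
  define z :: "complex ^ 'd" where "z = (\<chi> j. of_real (sqrt (\<mu> (X j) - lam j)))"
  have "pi_star X \<mu> = Upsilon lam z"
    using assms by (simp add: pi_star_eq_Upsilon_iff z_def less_imp_le)
  then show "z \<in> zero_level X lam" by (auto simp: zero_level_iff)
  show "z $ j \<noteq> 0" for j using assms[of j] by (simp add: z_def)
qed

end

section \<open>Polytopes\<close>

text \<open>If the normals do not span, the intersection of half spaces contains a line.\<close>

lemma surj_proj_if_bounded:
  fixes X :: "'d::finite \<Rightarrow> 'v::euclidean_space"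
  assumes bdd: "bounded (\<Inter>j. {\<mu> :: 'v \<Rightarrow>\<^sub>L real. \<mu> (X j) \<ge> lam j})" (is "bounded ?\<Delta>")
    and ne: "(\<Inter>j. {\<mu> :: 'v \<Rightarrow>\<^sub>L real. \<mu> (X j) \<ge> lam j}) \<noteq> {}"
  shows "surj (blinfun_apply (proj X))"
proof (rule ccontr)
  assume nsurj: "\<not> surj (blinfun_apply (proj X))"
  have lin: "linear (blinfun_apply (proj X))"
    by (simp add: bounded_linear.linear blinfun.bounded_linear_right)
  have span: "span (range (proj X)) = range (proj X)"
    using linear_subspace_image[OF lin subspace_UNIV] by (simp add: span_eq_iff)
  have "span (range (proj X)) \<noteq> UNIV" unfolding span by (rule nsurj)
  \<comment> \<open>The functional given by \<open>a\<close> vanishes on every normal, so adding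
    multiples of it to a point never leaves the polyhedron.\<close>
  from span_not_UNIV_orthogonal[OF this]
  obtain a where a: "a \<noteq> 0" "\<And>x. a \<bullet> proj X x = 0"
    by (metis span_base rangeI)
  have aX: "a \<bullet> X j = 0" for j
    using a(2)[of "axis j 1"] by (simp add: proj_axis)
  obtain \<mu> where \<mu>: "\<mu> \<in> ?\<Delta>" using ne by blast
  obtain B where B: "\<And>\<nu>. \<nu> \<in> ?\<Delta> \<Longrightarrow> norm \<nu> \<le> B" using bdd[unfolded bounded_iff] by (elim exE) blast
  \<comment> \<open>Chosen so that \<nu> takes the value \<open>norm a * B + 1\<close> at
    \<open>a\<close>, more than a functional of norm at most \<open>B\<close> can.\<close>
  define t where "t = (norm a * B + 1 - \<mu> a) / (a \<bullet> a)"
  define \<nu> where "\<nu> = \<mu> + t *\<^sub>R blinfun_inner_right a"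
  have "\<nu> \<in> ?\<Delta>" using \<mu> by (simp add: \<nu>_def blinfun.add_left blinfun.scaleR_left aX)
  then have "norm \<nu> * norm a \<le> B * norm a" by (intro mult_right_mono B) simp_all
  moreover have "\<nu> a = norm a * B + 1"
    using a(1) by (simp add: \<nu>_def t_def blinfun.add_left blinfun.scaleR_left)
  ultimately show False using norm_blinfun[of \<nu> a] by (simp add: mult.commute)
qed

text \<open>For each \<open>j\<close> some point is strict at \<open>j\<close>; the average of these
  points is strict everywhere, since the \<open>j\<close>-th inequality averages weak inequalities
  with at least one strict one.\<close>

lemma half_spaces_strict_point:
  fixes X :: "'d::finite \<Rightarrow> 'v::euclidean_space" and lam :: "'d \<Rightarrow> real"
  defines "\<Delta> \<equiv> (\<Inter>j. {\<mu> :: 'v \<Rightarrow>\<^sub>L real. \<mu> (X j) \<ge> lam j})"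
  assumes facets: "\<And>j. {\<mu> \<in> \<Delta>. blinfun_apply \<mu> (X j) = lam j} \<noteq> \<Delta>"
  obtains \<mu> :: "'v \<Rightarrow>\<^sub>L real" where "\<And>j. \<mu> (X j) > lam j"
proof -
  have "\<exists>\<mu> :: 'v \<Rightarrow>\<^sub>L real. \<mu> \<in> \<Delta> \<and> \<mu> (X j) > lam j" for j
  proof -
    obtain \<mu> where "\<mu> \<in> \<Delta>" "\<mu> (X j) \<noteq> lam j" using facets[of j] by blast
    then show ?thesis unfolding \<Delta>_def by (intro exI[of _ \<mu>]) (auto simp: less_le)
  qed
  then obtain m :: "'d \<Rightarrow> ('v \<Rightarrow>\<^sub>L real)"
    where m: "\<And>j. m j \<in> \<Delta>" "\<And>j. m j (X j) > lam j" by metis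
  define \<mu> where "\<mu> = (1 / real CARD('d)) *\<^sub>R (\<Sum>i\<in>UNIV. m i)"
  have "\<mu> (X j) > lam j" for j
  proof -
    have "(\<Sum>i\<in>(UNIV :: 'd set). lam j) < (\<Sum>i\<in>UNIV. m i (X j))"
      by (rule sum_strict_mono_ex1) (use m in \<open>auto simp: \<Delta>_def\<close>)
    then show ?thesis
      by (simp add: \<mu>_def blinfun.scaleR_left blinfun.sum_left field_simps)
  qed
  then show thesis by (rule that)
qed

theorem proposition3p3:
  fixes X :: "'d::finite \<Rightarrow> 'v::euclidean_space"
    and lam :: "'d \<Rightarrow> real"
    and Q :: "'v set"
    and \<Delta> :: "('v \<Rightarrow>\<^sub>L real) set"
  assumes "polytope \<Delta>"
    and "hull_dim \<Delta> = DIM('v)"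
    and "\<Delta> = (\<Inter>j. {\<mu>. blinfun_apply \<mu> (X j) \<ge> lam j})"
    and "bij_betw (\<lambda>j. {\<mu> \<in> \<Delta>. blinfun_apply \<mu> (X j) = lam j}) UNIV {F. codim1_face_of F \<Delta>}"
    and "quasilattice Q"
    and "range X \<subseteq> Q"
  shows "faithful_action (quasitorus Q) (M_space X lam Q) (quasitorus_act X lam Q)
    \<and> (\<forall>t \<in> carrier torus. \<forall>z \<in> zero_level X lam.
           quasitorus_act X lam Q (torus_proj X Q t) (N_orbit X Q z) = N_orbit X Q (torus_act t z))
    \<and> continuous_map (prod_topology (quasitorus_topology Q) (M_topology X lam Q))
           (M_topology X lam Q) (\<lambda>(\<delta>, m). quasitorus_act X lam Q \<delta> m)
    \<and> compact_space (M_topology X lam Q)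
    \<and> (\<forall>z \<in> zero_level X lam. Upsilon lam z \<in> range (pi_star X) \<and>
           Phi X lam (N_orbit X Q z) = the_inv (pi_star X) (Upsilon lam z))
    \<and> continuous_map (M_topology X lam Q) euclidean (Phi X lam)
    \<and> Phi X lam ` M_space X lam Q = \<Delta>"
proof -
  have bdd: "bounded \<Delta>" using assms(1) by (rule polytope_imp_bounded)
  have "codim1_face_of {\<mu> \<in> \<Delta>. blinfun_apply \<mu> (X j) = lam j} \<Delta>" for j
    using bij_betw_apply[OF assms(4), of j] by simp
  then have facets: "{\<mu> \<in> \<Delta>. blinfun_apply \<mu> (X j) = lam j} \<noteq> \<Delta>" for j
    \<comment> \<open>A facet has smaller dimension than \<Delta>, hence is a proper face.\<close>
    unfolding codim1_face_of_def by (metis n_not_Suc_n Suc_eq_plus1)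
  \<comment> \<open>In an empty \<Delta> these faces would coincide with \<Delta>.\<close>
  then have ne: "\<Delta> \<noteq> {}" by blast
  interpret surjective_quasitorus_setting X Q
    using subgroup_quasilattice[OF assms(5)] assms(6)
      surj_proj_if_bounded[OF bdd[unfolded assms(3)] ne[unfolded assms(3)]]
    by (intro surjective_quasitorus_setting.intro quasitorus_setting.intro
        surjective_quasitorus_setting_axioms.intro)
  obtain \<mu> :: "'v \<Rightarrow>\<^sub>L real" where "\<And>j. \<mu> (X j) > lam j"
    using half_spaces_strict_point[where X = X and lam = lam] facets[unfolded assms(3)] by blast
  then obtain z where z: "z \<in> zero_level X lam" "\<And>j. z $ j \<noteq> 0"
    by (rule zero_level_generic_point) blast
  show ?thesis
  proof (intro conjI ballI)
    show "Upsilon lam z \<in> range (pi_star X)" if "z \<in> zero_level X lam" for z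
      using that by (metis zero_level_iff rangeI)
    show "Phi X lam ` M_space X lam Q = \<Delta>" unfolding assms(3) by (rule Phi_image)
    show "compact_space (M_topology X lam Q)" using bdd unfolding assms(3) by (rule compact_space_M)
  qed (intro faithful_action_quasitorus[OF z] quasitorus_act_torus continuous_map_quasitorus_act
      Phi_N_orbit continuous_map_Phi | assumption)+
qed

end
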